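(* Let $(V,q)$ be a $4$-dimensional (nondegenerate) quadratic space over a field $F$ (of arbitrary characteristic). For an isometry $\tau$ of $(V,q)$ the following conditions are equivalent: (1) $\tau$ is an interchange isometry. (2) There exists a hyperbolic basis $(x,y,w,z)$ of $(V,q)$ such that $(x,w)$ is a basis of $\mathrm{Fix}(\tau)$, $\tau(y)=y+w$ and $\tau(z)=z-x$. (3) $(\tau-\mathrm{id})^2=0$ and $\tau$ is indecomposable.
   Context: For a quadratic form $q:V\to F$ on a finite-dimensional vector space, the polar form is $\mathfrak{b}_q(u,v)=q(u+v)-q(u)-q(v)$. For a subspace $W$, $W^\perp=\{x\in V\mid \mathfrak{b}_q(x,y)=0\text{ for all }y\in W\}$; $W$ is regular if $W\cap W^\perp=\{0\}$. $(V,q)$ is called a quadratic space if $V$ is regular. $\mathrm{Fix}(\tau)=\{x\in V\mid\tau(x)=x\}$. An isometry $\tau$ of a $4$-dimensional quadratic space $(V,q)$ is an interchange isometry if $\mathrm{Fix}(\tau)$ is a $2$-dimensional totally isotropic subspace, i.e. $q(v)=0$ for all $v\in\mathrm{Fix}(\tau)$. A hyperbolic basis of the $4$-dimensional space $(V,q)$ is a basis $(x,y,w,z)$ with $q(x)=q(y)=q(w)=q(z)=0$, $\mathfrak{b}_q(x,y)=\mathfrak{b}_q(w,z)=1$, and $\mathfrak{b}_q=0$ on all other pairs of distinct basis vectors (i.e. $\mathfrak b_q(x,w)=\mathfrak b_q(x,z)=\mathfrak b_q(y,w)=\mathfrak b_q(y,z)=0$). An isometry $\tau$ is indecomposable if there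 is no $\tau$-invariant regular subspace $U$ of $V$ with $\{0\}\ne U\ne V$. *)

theory Defs
  imports Complex_Main
begin

text \<open>
  A vector space \<open>V\<close> over a field \<open>F\<close> is a type \<open>'v\<close> with a scalar multiplication
  \<open>scale :: 'f \<Rightarrow> 'v \<Rightarrow> 'v\<close> satisfying the library locale \<open>vector_space\<close>; the whole
  space is \<open>UNIV\<close>. The class \<open>field\<close> puts no restriction on the characteristic.
\<close>

definition polar_form :: "('v::ab_group_add \<Rightarrow> 'f::field) \<Rightarrow> 'v \<Rightarrow> 'v \<Rightarrow> 'f" where
  "polar_form q u v = q (u + v) - q u - q v"

locale quadratic_form = vector_space scale
  for scale :: "'f::field \<Rightarrow> 'v::ab_group_add \<Rightarrow> 'v" +
  fixes q :: "'v \<Rightarrow> 'f"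
  assumes finite_dim: "\<exists>B. finite B \<and> span B = UNIV"
    and q_scale: "q (scale a v) = a\<^sup>2 * q v"
    and polar_linear_left: "Vector_Spaces.linear scale (*) (\<lambda>u. polar_form q u v)"
    and polar_linear_right: "Vector_Spaces.linear scale (*) (\<lambda>v. polar_form q u v)"

definition orth_compl :: "('v::ab_group_add \<Rightarrow> 'f::field) \<Rightarrow> 'v set \<Rightarrow> 'v set" where
  "orth_compl q W = {x. \<forall>y\<in>W. polar_form q x y = 0}"

definition regular :: "('v::ab_group_add \<Rightarrow> 'f::field) \<Rightarrow> 'v set \<Rightarrow> bool" where
  "regular q W \<longleftrightarrow> W \<inter> orth_compl q W = {0}"

definition totally_isotropic :: "('v::ab_group_add \<Rightarrow> 'f::field) \<Rightarrow> 'v set \<Rightarrow> bool" where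
  "totally_isotropic q W \<longleftrightarrow> (\<forall>v\<in>W. q v = 0)"

locale quadratic_space = quadratic_form +
  assumes regular_UNIV: "regular q UNIV"

definition isometry ::
  "('f::field \<Rightarrow> 'v::ab_group_add \<Rightarrow> 'v) \<Rightarrow> ('v \<Rightarrow> 'f) \<Rightarrow> ('v \<Rightarrow> 'v) \<Rightarrow> bool" where
  "isometry scale q \<tau> \<longleftrightarrow>
     Vector_Spaces.linear scale scale \<tau> \<and> bij \<tau> \<and> (\<forall>v. q (\<tau> v) = q v)"

definition Fix :: "('v \<Rightarrow> 'v) \<Rightarrow> 'v set" where
  "Fix \<tau> = {x. \<tau> x = x}"

definition interchange_isometry ::
  "('f::field \<Rightarrow> 'v::ab_group_add \<Rightarrow> 'v) \<Rightarrow> ('v \<Rightarrow> 'f) \<Rightarrow> ('v \<Rightarrow> 'v) \<Rightarrow> bool" where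
  "interchange_isometry scale q \<tau> \<longleftrightarrow>
     isometry scale q \<tau> \<and> vector_space.dim scale (Fix \<tau>) = 2 \<and> totally_isotropic q (Fix \<tau>)"

definition basis_of ::
  "('f::field \<Rightarrow> 'v::ab_group_add \<Rightarrow> 'v) \<Rightarrow> 'v set \<Rightarrow> 'v list \<Rightarrow> bool" where
  "basis_of scale W bs \<longleftrightarrow>
     distinct bs \<and> \<not> module.dependent scale (set bs) \<and> module.span scale (set bs) = W"

definition hyperbolic_basis ::
  "('f::field \<Rightarrow> 'v::ab_group_add \<Rightarrow> 'v) \<Rightarrow> ('v \<Rightarrow> 'f) \<Rightarrow> 'v \<Rightarrow> 'v \<Rightarrow> 'v \<Rightarrow> 'v \<Rightarrow> bool" where
  "hyperbolic_basis scale q x y w z \<longleftrightarrow>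
     basis_of scale UNIV [x, y, w, z] \<and>
     q x = 0 \<and> q y = 0 \<and> q w = 0 \<and> q z = 0 \<and>
     polar_form q x y = 1 \<and> polar_form q w z = 1 \<and>
     polar_form q x w = 0 \<and> polar_form q x z = 0 \<and>
     polar_form q y w = 0 \<and> polar_form q y z = 0"

definition indecomposable ::
  "('f::field \<Rightarrow> 'v::ab_group_add \<Rightarrow> 'v) \<Rightarrow> ('v \<Rightarrow> 'f) \<Rightarrow> ('v \<Rightarrow> 'v) \<Rightarrow> bool" where
  "indecomposable scale q \<tau> \<longleftrightarrow>
     \<not> (\<exists>U. module.subspace scale U \<and> \<tau> ` U \<subseteq> U \<and> regular q U \<and> U \<noteq> {0} \<and> U \<noteq> UNIV)"

end

theory Submission imports Defs begin

text \<open>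
  Write \<open>N = \<tau> - id\<close>. If \<open>N\<^sup>2 = 0\<close> then \<open>N\<close> is skew-adjoint for the polar form \<open>b\<close>, its image is
  \<open>b\<close>-isotropic, and \<open>q (N v) = - b (v, N v)\<close>. The pivotal condition is \<open>b (v, N v) = 0\<close> for
  all \<open>v\<close>. If it fails at \<open>v\<close>, then \<open>v\<close> and \<open>N v\<close> span an invariant regular plane. If it holds,
  then every invariant regular subspace on which \<open>N\<close> does not vanish contains some \<open>y\<close>, \<open>z\<close> with
  \<open>b (N y, z) = 1\<close>, and correcting \<open>y\<close> and \<open>z\<close> by fixed vectors makes \<open>(- N z, y, N y, z)\<close> a
  hyperbolic basis, so that the subspace is everything. For an interchange isometry, \<open>N\<close> maps
  into \<open>(Fix \<tau>)\<^sup>\<bottom>\<close>, which by dimension equals \<open>Fix \<tau>\<close>; hence \<open>N\<^sup>2 = 0\<close> and \<open>q (N v) = 0\<close>.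
\<close>

section \<open>Polar forms and regular subspaces\<close>

context quadratic_form
begin

lemma polar_form_linear:
  "polar_form q (u + v) p = polar_form q u p + polar_form q v p"
  "polar_form q p (u + v) = polar_form q p u + polar_form q p v"
  "polar_form q (scale a u) p = a * polar_form q u p"
  "polar_form q p (scale a u) = a * polar_form q p u"
  "polar_form q (u - v) p = polar_form q u p - polar_form q v p"
  "polar_form q p (u - v) = polar_form q p u - polar_form q p v"
  "polar_form q (- u) p = - polar_form q u p"
  "polar_form q p (- u) = - polar_form q p u"
  "polar_form q 0 p = 0"
  "polar_form q p 0 = 0"
proof -
  interpret L: Vector_Spaces.linear scale "(*)" "\<lambda>u. polar_form q u v" for v
    by (rule polar_linear_left)
  interpret R: Vector_Spaces.linear scale "(*)" "\<lambda>v. polar_form q u v" for u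
    by (rule polar_linear_right)
  show "polar_form q (u + v) p = polar_form q u p + polar_form q v p"
    "polar_form q p (u + v) = polar_form q p u + polar_form q p v"
    "polar_form q (scale a u) p = a * polar_form q u p"
    "polar_form q p (scale a u) = a * polar_form q p u"
    "polar_form q (u - v) p = polar_form q u p - polar_form q v p"
    "polar_form q p (u - v) = polar_form q p u - polar_form q p v"
    "polar_form q (- u) p = - polar_form q u p"
    "polar_form q p (- u) = - polar_form q p u"
    "polar_form q 0 p = 0"
    "polar_form q p 0 = 0"
    by (simp_all only: L.add R.add L.scale R.scale L.diff R.diff L.neg R.neg L.zero R.zero)
qed

lemma polar_form_commute: "polar_form q u v = polar_form q v u"
  by (simp add: polar_form_def add.commute)

lemma q_add: "q (u + v) = q u + q v + polar_form q u v"
  by (simp add: polar_form_def)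

lemma q_minus: "q (- v) = q v"
  using q_scale[of "-1" v] by simp

lemma polar_form_self: "polar_form q v v = 2 * q v"
  \<comment> \<open>Comparing \<open>q (v + v)\<close> with \<open>4 * q v\<close> involves no
    division by 2, so every characteristic is covered.\<close>
  using q_scale[of 2 v] by (simp add: polar_form_def scale_left_distrib[of 1 1 v, simplified])

lemma totally_isotropic_polar_form:
  assumes "totally_isotropic q W" "subspace W" "u \<in> W" "v \<in> W"
  shows "polar_form q u v = 0"
  using assms by (simp add: totally_isotropic_def polar_form_def subspace_add)

lemma subspace_orthogonal: "subspace {v. polar_form q p v = 0}"
  by (auto simp: subspace_def polar_form_linear)

lemma regular_obtain:
  assumes "regular q U" "subspace U" "u \<in> U" "u \<noteq> 0"
  obtains v where "v \<in> U" "polar_form q u v = 1"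
proof -
  obtain v where "v \<in> U" "polar_form q u v \<noteq> 0"
    using assms by (auto simp: regular_def orth_compl_def)
  then show ?thesis
    using that[of "scale (inverse (polar_form q u v)) v"] assms(2)
    by (simp add: polar_form_linear subspace_scale)
qed

lemma regularI:
  assumes "0 \<in> U" and "\<And>u. u \<in> U \<Longrightarrow> (\<And>v. v \<in> U \<Longrightarrow> polar_form q u v = 0) \<Longrightarrow> u = 0"
  shows "regular q U"
  using assms by (auto simp: regular_def orth_compl_def polar_form_linear)

lemma regular_span_singleton:
  assumes "polar_form q u u \<noteq> 0"
  shows "regular q (span {u})"
proof (rule regularI)
  fix p assume "p \<in> span {u}" and 0: "\<And>v. v \<in> span {u} \<Longrightarrow> polar_form q p v = 0"
  then obtain k where "p = scale k u"
    by (auto simp: span_singleton)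
  then show "p = 0"
    using 0[of u] assms by (simp add: polar_form_linear span_base)
qed (rule span_zero)

text \<open>The Gram determinant of \<open>u\<close>, \<open>w\<close> is minus the square of
  \<open>polar_form q u w\<close>, whatever the value of \<open>polar_form q u u\<close>.
  Concretely, pairing with \<open>w\<close> kills the coefficient of \<open>u\<close>, and then
  pairing with \<open>u\<close> kills that of \<open>w\<close>.\<close>

lemma regular_span_pair:
  assumes "polar_form q w w = 0" "polar_form q u w \<noteq> 0"
  shows "regular q (span {u, w})"
proof (rule regularI)
  fix p assume "p \<in> span {u, w}" and 0: "\<And>v. v \<in> span {u, w} \<Longrightarrow> polar_form q p v = 0"
  then obtain k where k: "p - scale k u \<in> span {w}"
    by (auto simp: span_insert)
  then obtain l where l: "p - scale k u = scale l w"
    by (auto simp: span_singleton)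
  then have p: "p = scale k u + scale l w"
    by (simp add: algebra_simps)
  have "k = 0"
    using 0[of w] assms by (simp add: p polar_form_linear span_base)
  moreover have "l = 0"
    using 0[of u] assms \<open>k = 0\<close>
    by (simp add: p polar_form_linear polar_form_commute[of w u] span_base)
  ultimately show "p = 0"
    by (simp add: p)
qed (rule span_zero)

text \<open>\<open>hyperbolic_basis\<close> without the basis requirement: the relations alone force
  independence, and in dimension 4 also spanning, so only these equations have to be checked for
  constructed vectors.\<close>

definition hyperbolic_relations :: "'v \<Rightarrow> 'v \<Rightarrow> 'v \<Rightarrow> 'v \<Rightarrow> bool" where
  "hyperbolic_relations x y w z \<longleftrightarrow>
     q x = 0 \<and> q y = 0 \<and> q w = 0 \<and> q z = 0 \<and>
     polar_form q x y = 1 \<and> polar_form q w z = 1 \<and>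
     polar_form q x w = 0 \<and> polar_form q x z = 0 \<and>
     polar_form q y w = 0 \<and> polar_form q y z = 0"

lemma hyperbolic_polar_forms:
  assumes "hyperbolic_relations x y w z"
  shows
    "polar_form q x x = 0" "polar_form q y y = 0" "polar_form q w w = 0" "polar_form q z z = 0"
    "polar_form q x y = 1" "polar_form q y x = 1" "polar_form q w z = 1" "polar_form q z w = 1"
    "polar_form q x w = 0" "polar_form q w x = 0" "polar_form q x z = 0" "polar_form q z x = 0"
    "polar_form q y w = 0" "polar_form q w y = 0" "polar_form q y z = 0" "polar_form q z y = 0"
  using assms
  by (simp_all add: hyperbolic_relations_def polar_form_self polar_form_commute[of y x]
      polar_form_commute[of z w] polar_form_commute[of w x] polar_form_commute[of z x]
      polar_form_commute[of w y] polar_form_commute[of z y])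

lemma hyperbolic_distinct:
  assumes "hyperbolic_relations x y w z"
  shows "distinct [x, y, w, z]"
  using hyperbolic_polar_forms[OF assms] by auto

lemma hyperbolic_independent:
  assumes "hyperbolic_relations x y w z"
  shows "independent {x, y, w, z}"
proof -
  note h = hyperbolic_polar_forms[OF assms]
  have "\<forall>v\<in>{x, y, w, z}. f v = 0" if "(\<Sum>v\<in>{x, y, w, z}. scale (f v) v) = 0" for f
  proof -
    have s: "scale (f x) x + scale (f y) y + scale (f w) w + scale (f z) z = 0"
      using that hyperbolic_distinct[OF assms] by (simp add: add.assoc)
    have "polar_form q (scale (f x) x + scale (f y) y + scale (f w) w + scale (f z) z) p = 0" for p
      by (simp add: s polar_form_linear)
    \<comment> \<open>Pairing with one vector isolates the coefficient of its hyperbolic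
      partner.\<close>
    from this[of x] this[of y] this[of w] this[of z] show ?thesis
      by (simp add: polar_form_linear h)
  qed
  then show ?thesis
    by (auto simp: dependent_finite)
qed

end

section \<open>Dimension counts and isometries in dimension 4\<close>

locale four_dimensional_isometry = quadratic_space scale q
  for scale :: "'f::field \<Rightarrow> 'v::ab_group_add \<Rightarrow> 'v" and q +
  fixes \<tau> :: "'v \<Rightarrow> 'v"
  assumes dim_eq_4: "dim UNIV = 4"
    and isometry: "isometry scale q \<tau>"
begin

text \<open>A basis extracted from the finite spanning set makes the library results on
  finite-dimensional spaces available.\<close>

lemma finite_dimensional: "\<exists>B. finite_dimensional_vector_space scale B"
proof -
  obtain A where A: "finite A" "span A = UNIV"
    using finite_dim by blast
  obtain B where B: "B \<subseteq> A" "independent B" "A \<subseteq> span B"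
    by (rule maximal_independent_subset)
  have "finite B"
    using A B finite_subset by blast
  moreover have "span B = UNIV"
    using A B span_minimal[of A "span B"] by auto
  ultimately have "finite_dimensional_vector_space scale B"
    using B by unfold_locales
  then show ?thesis ..
qed

lemma spanning_if_card_4:
  assumes "independent B" "card B = 4"
  shows "span B = UNIV"
proof -
  obtain C where "finite_dimensional_vector_space scale C"
    using finite_dimensional by blast
  then interpret finite_dimensional_vector_space scale C .
  have "dim UNIV \<le> card B"
    by (simp only: dim_eq_4 assms)
  then show ?thesis
    using card_ge_dim_independent[of B UNIV] assms(1) by blast
qed

lemma hyperbolic_basis_iff:
  "hyperbolic_basis scale q x y w z \<longleftrightarrow> hyperbolic_relations x y w z"
proof
  assume h: "hyperbolic_relations x y w z"
  have "card {x, y, w, z} = 4"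
    using hyperbolic_distinct[OF h] by simp
  then have "span {x, y, w, z} = UNIV"
    using hyperbolic_independent[OF h] spanning_if_card_4 by blast
  then show "hyperbolic_basis scale q x y w z"
    using h hyperbolic_distinct[OF h] hyperbolic_independent[OF h]
    by (auto simp: hyperbolic_basis_def basis_of_def hyperbolic_relations_def)
qed (auto simp: hyperbolic_basis_def hyperbolic_relations_def)

lemma span_proper:
  assumes "finite B" "card B < 4"
  shows "span B \<noteq> UNIV"
proof
  assume "span B = UNIV"
  then have "dim UNIV \<le> card B"
    using dim_le_card[of UNIV B] assms by simp
  then show False
    using assms dim_eq_4 by simp
qed

lemma tau_linear:
  "\<tau> (u + v) = \<tau> u + \<tau> v" "\<tau> (u - v) = \<tau> u - \<tau> v"
  "\<tau> (scale a u) = scale a (\<tau> u)" "\<tau> 0 = 0"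
proof -
  interpret L: Vector_Spaces.linear scale scale \<tau>
    using isometry by (simp add: isometry_def)
  show "\<tau> (u + v) = \<tau> u + \<tau> v" "\<tau> (u - v) = \<tau> u - \<tau> v"
    "\<tau> (scale a u) = scale a (\<tau> u)" "\<tau> 0 = 0"
    by (rule L.add L.diff L.scale L.zero)+
qed

lemma q_tau: "q (\<tau> v) = q v"
  using isometry by (simp add: isometry_def)

lemma polar_form_tau: "polar_form q (\<tau> u) (\<tau> v) = polar_form q u v"
  by (simp add: polar_form_def q_tau flip: tau_linear)

lemma subspace_Fix: "subspace (Fix \<tau>)"
  by (auto simp: subspace_def Fix_def tau_linear)

section \<open>The operator \<tau> - id\<close>

definition N :: "'v \<Rightarrow> 'v" where
  "N v = \<tau> v - v"

lemma Fix_iff: "v \<in> Fix \<tau> \<longleftrightarrow> N v = 0"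
  by (simp add: Fix_def N_def)

lemma N_linear:
  "N (u + v) = N u + N v" "N (u - v) = N u - N v" "N (scale a u) = scale a (N u)"
  "N 0 = 0"
  by (simp_all add: N_def tau_linear scale_right_diff_distrib)

lemma N_minus: "N (- v) = - N v"
  using N_linear(3)[of "-1" v] by simp

text \<open>Expand \<open>q (v + N v) = q v\<close>. This links isotropy of the image of
  \<open>N\<close> to the condition \<open>polar_form q v (N v) = 0\<close>.\<close>

lemma q_N: "q (N v) = - polar_form q v (N v)"
  using q_add[of v "N v"] q_tau[of v] by (simp add: N_def eq_neg_iff_add_eq_0 add.commute)

lemma polar_form_N_N:
  "polar_form q (N u) (N v) = - polar_form q (N u) v - polar_form q u (N v)"
  using polar_form_tau[of u v] by (simp add: N_def polar_form_linear algebra_simps)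

lemma N_skew_adjoint:
  assumes "\<And>v. N (N v) = 0"
  shows "polar_form q (N u) (N v) = 0" "polar_form q (N u) v = - polar_form q u (N v)"
proof -
  show 0: "polar_form q (N u) (N v) = 0" for u v
    \<comment> \<open>With \<open>N v\<close> in place of \<open>v\<close>, both terms containing
      \<open>N (N v)\<close> vanish and only \<open>polar_form q (N u) (N v)\<close>
      remains.\<close>
    using polar_form_N_N[of u "N v"] by (simp add: assms polar_form_linear)
  show "polar_form q (N u) v = - polar_form q u (N v)"
    using polar_form_N_N[of u v] 0[of u v] by (simp add: algebra_simps)
qed

section \<open>Construction and properties of interchange bases\<close>

definition interchange_basis :: "'v \<Rightarrow> 'v \<Rightarrow> 'v \<Rightarrow> 'v \<Rightarrow> bool" where
  "interchange_basis x y w z \<longleftrightarrow>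
     hyperbolic_relations x y w z \<and> N x = 0 \<and> N y = w \<and> N w = 0 \<and> N z = - x"

text \<open>Working inside \<open>U\<close> serves two purposes: \<open>U = UNIV\<close> yields
  existence of the basis, while for an arbitrary invariant regular \<open>U\<close> the four vectors
  found in it force \<open>U = UNIV\<close>.\<close>

lemma interchange_basis_in_regular_subspace:
  assumes NN: "\<And>v. N (N v) = 0" and alt: "\<And>v. polar_form q v (N v) = 0"
    and U: "subspace U" "regular q U" and inv: "\<And>v. v \<in> U \<Longrightarrow> N v \<in> U"
    and u: "u \<in> U" "N u \<noteq> 0"
  obtains x y w z where "{x, y, w, z} \<subseteq> U" "interchange_basis x y w z"
proof -
  obtain v where v: "v \<in> U" "polar_form q (N u) v = 1"
    using regular_obtain[OF U(2,1) inv[OF u(1)] u(2)] by blast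
  \<comment> \<open>These choices are forced by \<open>N y = w\<close> and \<open>N z = - x\<close>,
    as \<open>y\<close> and \<open>z\<close> differ from \<open>u\<close> and \<open>v\<close> only
    by elements of the kernel of \<open>N\<close>.\<close>
  define w x where "w = N u" and "x = - N v"
  \<comment> \<open>Since \<open>polar_form q w v = 1\<close>, this makes \<open>y'\<close>
    orthogonal to \<open>v\<close>. The multiples of \<open>x\<close> and \<open>w\<close>
    subtracted next make \<open>y\<close> and \<open>z\<close> isotropic, because \<open>y'\<close>
    pairs to 1 with \<open>x\<close>, and \<open>v\<close> to 1 with \<open>w\<close>.\<close>
  define y' where "y' = u - scale (polar_form q u v) w"
  define y where "y = y' - scale (q y') x"
  define z where "z = v - scale (q v) w"
  have q0: "q w = 0" "q x = 0"
    by (simp_all add: w_def x_def q_minus q_N alt)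
  \<comment> \<open>Skew-adjointness carries the normalization of the pair \<open>w\<close>,
    \<open>v\<close> over to the pair \<open>x\<close>, \<open>u\<close>.\<close>
  have "polar_form q u x = 1"
    using N_skew_adjoint(2)[OF NN, of u v] v by (simp add: x_def polar_form_linear)
  moreover have "polar_form q v x = 0"
    by (simp add: x_def polar_form_linear alt)
  moreover have "polar_form q u w = 0" "polar_form q w v = 1"
    using v by (simp_all add: w_def alt)
  moreover have "polar_form q w x = 0"
    by (simp add: w_def x_def polar_form_linear N_skew_adjoint(1)[OF NN])
  ultimately have b:
    "polar_form q u x = 1" "polar_form q x u = 1" "polar_form q v x = 0" "polar_form q x v = 0"
    "polar_form q u w = 0" "polar_form q w u = 0" "polar_form q w v = 1" "polar_form q v w = 1"
    "polar_form q w x = 0" "polar_form q x w = 0" "polar_form q w w = 0" "polar_form q x x = 0"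
    using q0 by (simp_all add: polar_form_commute polar_form_self)
  have "polar_form q y' x = 1"
    by (simp add: y'_def polar_form_linear b)
  then have "q y = 0"
    using q_add[of y' "- scale (q y') x"]
    by (simp add: y_def q_minus q_scale q0 polar_form_linear)
  moreover have "q z = 0"
    using q_add[of v "- scale (q v) w"]
    by (simp add: z_def q_minus q_scale q0 polar_form_linear b)
  ultimately have "hyperbolic_relations x y w z"
    using q0 by (simp add: hyperbolic_relations_def y_def y'_def z_def polar_form_linear b)
  moreover have "N x = 0" "N w = 0"
    by (simp_all add: x_def w_def N_minus NN)
  then have "N y = w" "N z = - x"
    by (simp_all add: y_def y'_def z_def N_linear) (simp_all add: w_def x_def)
  ultimately have "interchange_basis x y w z"
    using \<open>N x = 0\<close> \<open>N w = 0\<close> by (simp add: interchange_basis_def)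
  moreover have "w \<in> U" "x \<in> U"
    using U(1) u v inv by (simp_all add: w_def x_def subspace_neg)
  then have "{x, y, w, z} \<subseteq> U"
    using U(1) u v by (simp add: y_def y'_def z_def subspace_diff subspace_scale)
  ultimately show ?thesis
    using that by blast
qed

lemma hyperbolic_span:
  assumes "hyperbolic_relations x y w z"
  shows "span {x, y, w, z} = UNIV"
  using hyperbolic_independent[OF assms] hyperbolic_distinct[OF assms]
  by (intro spanning_if_card_4) simp_all

lemma interchange_basis_expand:
  assumes "interchange_basis x y w z"
  obtains a b c d where "v = scale a x + scale b y + scale c w + scale d z"
    "N v = scale b w - scale d x"
proof -
  have "v \<in> span {x, y, w, z}"
    using assms hyperbolic_span by (simp add: interchange_basis_def)
  then obtain a b c d where "v - scale a x - scale b y - scale c w = scale d z"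
    unfolding span_insert[of x] span_insert[of y] span_insert[of w] span_singleton by auto
  then have v: "v = scale a x + scale b y + scale c w + scale d z"
    by (simp add: algebra_simps)
  moreover have "N v = scale b w - scale d x"
    using assms by (simp add: v N_linear interchange_basis_def)
  ultimately show ?thesis
    using that by blast
qed

lemma interchange_basis_Fix:
  assumes "interchange_basis x y w z"
  shows "Fix \<tau> = span {x, w}"
proof
  note h = hyperbolic_polar_forms[of x y w z]
  have rel: "hyperbolic_relations x y w z"
    using assms by (simp add: interchange_basis_def)
  show "Fix \<tau> \<subseteq> span {x, w}"
  proof
    fix v assume "v \<in> Fix \<tau>"
    obtain a b c d where v: "v = scale a x + scale b y + scale c w + scale d z"
      and "N v = scale b w - scale d x"
      using interchange_basis_expand[OF assms] by blast
    then have 0: "scale b w - scale d x = 0"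
      using \<open>v \<in> Fix \<tau>\<close> by (simp add: Fix_iff)
    have "polar_form q (scale b w - scale d x) p = 0" for p
      by (simp add: 0 polar_form_linear)
    \<comment> \<open>Pairing with \<open>z\<close> isolates \<open>b\<close>, pairing with
      \<open>y\<close> isolates \<open>- d\<close>.\<close>
    from this[of z] this[of y] have "b = 0" "d = 0"
      by (simp_all add: polar_form_linear h[OF rel])
    then show "v \<in> span {x, w}"
      by (simp add: v span_add span_scale span_base)
  qed
  show "span {x, w} \<subseteq> Fix \<tau>"
    using assms by (intro span_minimal subspace_Fix) (simp add: Fix_iff interchange_basis_def)
qed

text \<open>Identifies the equations in terms of \<open>N\<close> with condition (2). That
  \<open>x\<close> and \<open>w\<close> span all of \<open>Fix \<tau>\<close> is recovered from the
  action of \<open>N\<close> in coordinates.\<close>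

lemma interchange_basis_iff:
  "interchange_basis x y w z \<longleftrightarrow>
     hyperbolic_basis scale q x y w z \<and> basis_of scale (Fix \<tau>) [x, w] \<and>
     \<tau> y = y + w \<and> \<tau> z = z - x"
proof
  assume b: "interchange_basis x y w z"
  then have rel: "hyperbolic_relations x y w z"
    by (simp add: interchange_basis_def)
  have "independent {x, w}"
    by (rule independent_mono[OF hyperbolic_independent[OF rel]]) auto
  then have "basis_of scale (Fix \<tau>) [x, w]"
    using hyperbolic_distinct[OF rel] interchange_basis_Fix[OF b] by (simp add: basis_of_def)
  then show "hyperbolic_basis scale q x y w z \<and> basis_of scale (Fix \<tau>) [x, w] \<and>
     \<tau> y = y + w \<and> \<tau> z = z - x"
    using b by (simp add: hyperbolic_basis_iff interchange_basis_def N_def algebra_simps)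
next
  assume b: "hyperbolic_basis scale q x y w z \<and> basis_of scale (Fix \<tau>) [x, w] \<and>
     \<tau> y = y + w \<and> \<tau> z = z - x"
  then have "x \<in> Fix \<tau>" "w \<in> Fix \<tau>"
    using span_superset[of "{x, w}"] by (auto simp: basis_of_def)
  then show "interchange_basis x y w z"
    using b by (simp add: interchange_basis_def hyperbolic_basis_iff Fix_iff) (simp add: N_def)
qed

lemma interchange_basis_imp_isometry:
  assumes "interchange_basis x y w z"
  shows "interchange_isometry scale q \<tau>"
proof -
  have rel: "hyperbolic_relations x y w z"
    using assms by (simp add: interchange_basis_def)
  have basis: "x \<noteq> w" "independent {x, w}" "span {x, w} = Fix \<tau>"
    using assms by (simp_all add: interchange_basis_iff basis_of_def)
  have "dim (Fix \<tau>) = 2"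
    using dim_eq_card_independent[OF basis(2)] basis dim_span[of "{x, w}"] by simp
  moreover have "q v = 0" if v: "v \<in> span {x, w}" for v
  proof -
    obtain a c where "v - scale a x = scale c w"
      using v unfolding span_insert[of x] span_singleton by auto
    then have "v = scale a x + scale c w"
      by (simp add: algebra_simps)
    then show ?thesis
      using rel hyperbolic_polar_forms[OF rel]
      by (simp add: q_add q_scale polar_form_linear hyperbolic_relations_def)
  qed
  ultimately show ?thesis
    using isometry basis by (auto simp: interchange_isometry_def totally_isotropic_def)
qed

section \<open>From interchange isometries to interchange bases\<close>

text \<open>If \<open>p\<close> were outside \<open>W\<close>, some \<open>r\<close> would complete
  \<open>p\<close> and a basis of \<open>W\<close> to a basis of the space. As \<open>W\<close> is
  orthogonal to itself and to \<open>p\<close>, regularity makes pairing with \<open>r\<close>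
  injective on \<open>W\<close>, which is impossible for a linear functional on a plane.\<close>

lemma orthogonal_to_plane:
  assumes "subspace W" "dim W = 2" "totally_isotropic q W"
    and p: "\<And>v. v \<in> W \<Longrightarrow> polar_form q v p = 0"
  shows "p \<in> W"
proof (rule ccontr)
  assume "p \<notin> W"
  obtain B where B: "B \<subseteq> W" "independent B" "W \<subseteq> span B" "card B = 2"
    using basis_exists[of W] assms(2) by metis
  then obtain e f where ef: "B = {e, f}" "e \<noteq> f"
    by (auto simp: card_2_iff)
  have W: "W = span {e, f}"
    using B ef assms(1) span_minimal by blast
  have "independent {p, e, f}"
    using B ef \<open>p \<notin> W\<close> W independent_insert by auto
  have "p \<noteq> e" "p \<noteq> f"
    using \<open>p \<notin> W\<close> B ef by auto
  then have "span {p, e, f} \<noteq> UNIV"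
    using ef by (intro span_proper) auto
  then obtain r where r: "r \<notin> span {p, e, f}"
    by auto
  have "independent {r, p, e, f}"
    using r \<open>independent {p, e, f}\<close> independent_insert by auto
  moreover have "r \<noteq> p" "r \<noteq> e" "r \<noteq> f"
    using r span_base[of _ "{p, e, f}"] by auto
  ultimately have all: "span {r, p, e, f} = UNIV"
    using \<open>p \<noteq> e\<close> \<open>p \<noteq> f\<close> \<open>e \<noteq> f\<close> by (intro spanning_if_card_4) simp_all
  have zero: "v = 0" if v: "v \<in> W" "polar_form q v r = 0" for v
  proof (rule ccontr)
    assume "v \<noteq> 0"
    \<comment> \<open>Such a \<open>v\<close> is orthogonal to a whole basis, so it lies in the
      radical of a regular space.\<close>
    have "{r, p, e, f} \<subseteq> {u. polar_form q v u = 0}"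
      using v p totally_isotropic_polar_form[OF assms(3,1) v(1)] B ef by auto
    then have "span {r, p, e, f} \<subseteq> {u. polar_form q v u = 0}"
      by (intro span_minimal subspace_orthogonal)
    then have "polar_form q v u = 0" for u
      using all by auto
    moreover obtain u where "polar_form q v u = 1"
      using regular_obtain[OF regular_UNIV subspace_UNIV _ \<open>v \<noteq> 0\<close>] by blast
    ultimately show False
      by simp
  qed
  have "e \<in> W" "f \<in> W"
    using B ef by auto
  \<comment> \<open>A linear functional on a plane has a nonzero kernel.\<close>
  define v where "v = scale (polar_form q f r) e - scale (polar_form q e r) f"
  have "v = 0"
    using \<open>e \<in> W\<close> \<open>f \<in> W\<close> assms(1)
    by (intro zero) (simp_all add: v_def polar_form_linear subspace_diff subspace_scale)
  have "polar_form q e r \<noteq> 0"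
    using zero[OF \<open>e \<in> W\<close>] B(2) ef dependent_zero by blast
  have eq: "scale (polar_form q e r) f = scale (polar_form q f r) e"
    using \<open>v = 0\<close> by (simp add: v_def)
  have "f = scale (inverse (polar_form q e r)) (scale (polar_form q f r) e)"
    unfolding eq[symmetric] using \<open>polar_form q e r \<noteq> 0\<close> by simp
  then have "f \<in> span {e}"
    by (metis span_scale span_base singletonI)
  then show False
    using B(2) ef by (auto simp: insert_commute[of e f] independent_insert)
qed

lemma ex_interchange_basis:
  assumes "\<And>v. N (N v) = 0" "\<And>v. polar_form q v (N v) = 0" "N u \<noteq> 0"
  shows "\<exists>x y w z. interchange_basis x y w z"
  by (rule interchange_basis_in_regular_subspace[OF assms(1,2) subspace_UNIV regular_UNIV _ _ assms(3)])
    auto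

lemma interchange_isometry_imp_basis:
  assumes "interchange_isometry scale q \<tau>"
  shows "\<exists>x y w z. interchange_basis x y w z"
proof -
  have F: "dim (Fix \<tau>) = 2" "totally_isotropic q (Fix \<tau>)"
    using assms by (simp_all add: interchange_isometry_def)
  have N_Fix: "N v \<in> Fix \<tau>" for v
  proof (rule orthogonal_to_plane[OF subspace_Fix F])
    fix p assume "p \<in> Fix \<tau>"
    \<comment> \<open>For fixed \<open>p\<close>, invariance of the polar form reads
      \<open>polar_form q p (\<tau> v) = polar_form q p v\<close>.\<close>
    then show "polar_form q p (N v) = 0"
      using polar_form_tau[of p v] by (simp add: Fix_def N_def polar_form_linear)
  qed
  \<comment> \<open>The second equation becomes \<open>polar_form q v (N v) = 0\<close> through
    \<open>q_N\<close>.\<close>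
  then have "N (N v) = 0" "q (N v) = 0" for v
    using F by (auto simp: Fix_iff totally_isotropic_def)
  moreover have "\<exists>u. N u \<noteq> 0"
  proof (rule ccontr)
    assume "\<nexists>u. N u \<noteq> 0"
    then have "Fix \<tau> = UNIV"
      by (auto simp: Fix_iff)
    then show False
      using F(1) dim_eq_4 by simp
  qed
  ultimately show ?thesis
    using ex_interchange_basis q_N by auto
qed

section \<open>Invariant subspaces and indecomposability\<close>

lemma invariant_iff:
  assumes "subspace U"
  shows "\<tau> ` U \<subseteq> U \<longleftrightarrow> (\<forall>v\<in>U. N v \<in> U)"
proof -
  have "\<tau> v \<in> U \<longleftrightarrow> N v \<in> U" if "v \<in> U" for v
    using that subspace_add[OF assms, of "N v" v] subspace_diff[OF assms, of "\<tau> v" v]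
    by (auto simp: N_def)
  then show ?thesis
    by auto
qed

text \<open>The vectors that \<open>N\<close> maps into \<open>span B\<close> form a subspace, so
  invariance need only be checked on the generators.\<close>

lemma not_indecomposable_span:
  assumes "finite B" "card B < 4" "regular q (span B)" "\<And>v. v \<in> B \<Longrightarrow> N v \<in> span B"
    "u \<in> B" "u \<noteq> 0"
  shows "\<not> indecomposable scale q \<tau>"
proof -
  have "subspace {v. N v \<in> span B}"
    by (auto simp: subspace_def N_linear span_add span_scale span_zero)
  then have "span B \<subseteq> {v. N v \<in> span B}"
    using assms(4) by (intro span_minimal) auto
  then have "\<tau> ` span B \<subseteq> span B"
    by (auto simp: invariant_iff)
  moreover have "span B \<noteq> {0}"
    using assms span_base by auto
  ultimately show ?thesis
    using assms(3) span_proper[OF assms(1,2)] by (auto simp: indecomposable_def)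
qed

lemma indecomposable_imp_alternating:
  assumes NN: "\<And>v. N (N v) = 0" and "indecomposable scale q \<tau>"
  shows "polar_form q v (N v) = 0"
proof (rule ccontr)
  assume *: "polar_form q v (N v) \<noteq> 0"
  \<comment> \<open>\<open>N v\<close> pairs to 0 with itself by \<open>N_skew_adjoint\<close>, and
    nontrivially with \<open>v\<close> by assumption.\<close>
  then have "regular q (span {v, N v})"
    by (intro regular_span_pair N_skew_adjoint NN)
  moreover have "v \<noteq> 0"
    using * by (auto simp: polar_form_linear)
  moreover have "card {v, N v} < 4"
    by (simp add: card_insert_if)
  ultimately have "\<not> indecomposable scale q \<tau>"
    by (intro not_indecomposable_span[of "{v, N v}" v]) (auto simp: NN span_base span_zero)
  with assms show False
    by simp
qed

text \<open>If \<open>N\<close> vanished, every subspace would be invariant, so a nonzero proper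
  regular one gives a contradiction: a line spanned by \<open>f\<close> if
  \<open>polar_form q f f \<noteq> 0\<close>, and otherwise a plane containing \<open>f\<close> and
  a partner \<open>e\<close>.\<close>

lemma indecomposable_imp_N_nonzero:
  assumes "indecomposable scale q \<tau>"
  shows "\<exists>u. N u \<noteq> 0"
proof (rule ccontr)
  assume "\<nexists>u. N u \<noteq> 0"
  then have N0: "N v = 0" for v
    by simp
  obtain e :: 'v where "e \<noteq> 0"
    using span_proper[of "{}"] by auto
  then obtain f where ef: "polar_form q e f = 1"
    using regular_obtain[OF regular_UNIV subspace_UNIV] by blast
  have "f \<noteq> 0"
    using ef by (auto simp: polar_form_linear)
  \<comment> \<open>In characteristic 2 every line is degenerate, so a plane is needed.\<close>
  show False
  proof (cases "polar_form q f f = 0")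
    case True
    then have "regular q (span {e, f})"
      using ef by (intro regular_span_pair) simp_all
    moreover have "card {e, f} < 4"
      by (simp add: card_insert_if)
    ultimately show False
      using assms not_indecomposable_span[of "{e, f}" f] \<open>f \<noteq> 0\<close> by (auto simp: N0 span_zero)
  next
    case False
    then show False
      using assms not_indecomposable_span[of "{f}" f] \<open>f \<noteq> 0\<close> regular_span_singleton[of f]
      by (auto simp: N0 span_zero)
  qed
qed

text \<open>Coordinates give the two identities for \<open>N\<close>. A nonzero invariant regular
  subspace cannot lie in the totally isotropic \<open>Fix \<tau>\<close>, so \<open>N\<close> is
  nonzero on it and it contains a full interchange basis.\<close>

lemma interchange_basis_imp_indecomposable:
  assumes b: "interchange_basis x y w z"
  shows "N (N v) = 0" "indecomposable scale q \<tau>"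
proof -
  have rel: "hyperbolic_relations x y w z"
    using b by (simp add: interchange_basis_def)
  have NN: "N (N v) = 0" and alt: "polar_form q v (N v) = 0" for v
  proof -
    obtain a k c d where v: "v = scale a x + scale k y + scale c w + scale d z"
      "N v = scale k w - scale d x"
      using interchange_basis_expand[OF b] by blast
    show "N (N v) = 0"
      using b by (simp add: v(2) N_linear interchange_basis_def)
    \<comment> \<open>Here \<open>v\<close> pairs to \<open>d\<close> with \<open>w\<close> and to
      \<open>k\<close> with \<open>x\<close>, so the value is \<open>k * d - d * k\<close>.
      \<open>N v\<close> is rewritten first, before \<open>v\<close> itself is expanded.\<close>
    show "polar_form q v (N v) = 0"
      unfolding v(2) unfolding v(1)
      by (simp add: polar_form_linear hyperbolic_polar_forms[OF rel] algebra_simps)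
  qed
  show "N (N v) = 0"
    by (rule NN)
  have "U = UNIV" if U: "subspace U" "\<tau> ` U \<subseteq> U" "regular q U" "U \<noteq> {0}" for U
  proof -
    have "\<exists>u\<in>U. N u \<noteq> 0"
    proof (rule ccontr)
      assume "\<not> (\<exists>u\<in>U. N u \<noteq> 0)"
      then have "U \<subseteq> Fix \<tau>"
        by (auto simp: Fix_iff)
      moreover have "totally_isotropic q (Fix \<tau>)"
        using interchange_basis_imp_isometry[OF b] by (simp add: interchange_isometry_def)
      ultimately have "totally_isotropic q U"
        by (auto simp: totally_isotropic_def)
      \<comment> \<open>Total isotropy puts \<open>U\<close> inside its own orthogonal complement,
        and regularity then leaves only \<open>{0}\<close>.\<close>
      then have "U \<inter> orth_compl q U = U"
        using totally_isotropic_polar_form[of U] U(1) by (auto simp: orth_compl_def)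
      then show False
        using U by (simp add: regular_def)
    qed
    then obtain u where u: "u \<in> U" "N u \<noteq> 0"
      by blast
    have inv: "N v \<in> U" if "v \<in> U" for v
      using U(1,2) that by (simp add: invariant_iff)
    obtain x' y' w' z' where "{x', y', w', z'} \<subseteq> U" "interchange_basis x' y' w' z'"
      by (rule interchange_basis_in_regular_subspace[OF NN alt U(1,3) inv u])
    then show "U = UNIV"
      using hyperbolic_span[of x' y' w' z'] span_minimal[of "{x', y', w', z'}" U] U(1)
      by (auto simp: interchange_basis_def)
  qed
  then show "indecomposable scale q \<tau>"
    by (auto simp: indecomposable_def)
qed

section \<open>Equivalence of the three conditions\<close>

lemma interchange_equivalence:
  "(interchange_isometry scale q \<tau> \<longleftrightarrow> (\<exists>x y w z. interchange_basis x y w z)) \<and>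
   ((\<exists>x y w z. interchange_basis x y w z) \<longleftrightarrow>
      (\<forall>v. N (N v) = 0) \<and> indecomposable scale q \<tau>)"
proof -
  have "\<exists>x y w z. interchange_basis x y w z"
    if NN: "\<forall>v. N (N v) = 0" and ind: "indecomposable scale q \<tau>"
  proof -
    obtain u where "N u \<noteq> 0"
      using ind indecomposable_imp_N_nonzero by blast
    then show ?thesis
      using indecomposable_imp_alternating NN ind by (intro ex_interchange_basis) auto
  qed
  then show ?thesis
    using interchange_isometry_imp_basis interchange_basis_imp_isometry
      interchange_basis_imp_indecomposable by blast
qed

end

theorem proposition3p5:
  fixes scale :: "'f::field \<Rightarrow> 'v::ab_group_add \<Rightarrow> 'v"
    and q :: "'v \<Rightarrow> 'f"
    and \<tau> :: "'v \<Rightarrow> 'v"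
  assumes "quadratic_space scale q"
    and "vector_space.dim scale (UNIV :: 'v set) = 4"
    and "isometry scale q \<tau>"
  shows "(interchange_isometry scale q \<tau> \<longleftrightarrow>
            (\<exists>x y w z. hyperbolic_basis scale q x y w z \<and> basis_of scale (Fix \<tau>) [x, w] \<and>
               \<tau> y = y + w \<and> \<tau> z = z - x)) \<and>
         ((\<exists>x y w z. hyperbolic_basis scale q x y w z \<and> basis_of scale (Fix \<tau>) [x, w] \<and>
               \<tau> y = y + w \<and> \<tau> z = z - x) \<longleftrightarrow>
            ((\<lambda>v. \<tau> v - v) ^^ 2 = (\<lambda>v. 0) \<and> indecomposable scale q \<tau>))"
proof -
  interpret quadratic_space scale q
    by (rule assms(1))
  interpret four_dimensional_isometry scale q \<tau>
    using assms by unfold_locales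
  \<comment> \<open>On functions, \<open>^^ 2\<close> is twofold composition, so this is the
    operator square of \<tau> - id.\<close>
  have "(\<lambda>v. \<tau> v - v) ^^ 2 = (\<lambda>v. 0) \<longleftrightarrow> (\<forall>v. N (N v) = 0)"
    by (simp add: numeral_2_eq_2 fun_eq_iff N_def)
  then show ?thesis
    using interchange_equivalence by (simp only: interchange_basis_iff)
qed

end
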